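(* Over data $\omega$-words, every formula of $\mathsf{Formulas}(\{\mathtt Y^g,\mathtt Y^c\})$ is equivalent to a formula of the $\nu$-fragment. Consequently, over data words and over data $\omega$-words, every formula of $\mathsf{Comp}(\mathsf{Formulas}(\{\mathtt Y^g,\mathtt Y^c\})\cup \nu\text{-fragment})$ is equivalent to a formula of the $\nu$-fragment, i.e. $\mathsf{Comp}(\mathsf{Formulas}(\{\mathtt Y^g,\mathtt Y^c\})\cup\nu\text{-fragment})=\nu\text{-fragment}$ up to equivalence.
   Context: Data words (data $\omega$-words) are finite (infinite) sequences over $\Sigma\times\mathcal D$ ($\Sigma$ finite alphabet, $\mathcal D$ infinite); $i\sim j$ iff positions $i,j$ carry the same data value; the class successor/predecessor of $i$ is the nearest later/earlier position $j\sim i$. $\mu$-calculus: $\varphi::= x\mid A\mid\neg A\mid \mathsf M\varphi\mid\varphi\vee\varphi\mid\varphi\wedge\varphi\mid\mu x.\varphi\mid\nu x.\varphi$, with fixpoint variables $x$, atoms $A$: letters of $\Sigma$ and zeroary $\mathsf S,\mathsf P,\mathsf{first}^g,\mathsf{last}^g,\mathsf{first}^c,\mathsf{last}^c$; unary modalities $\mathsf M\in\{\mathtt X^g,\mathtt X^c,\mathtt Y^g,\mathtt Y^c\}$ evaluating the argument at the successor, class successor, predecessor, class predecessor respectively (false if nonexistent). Letters hold where they label the position; $\mathsf{first}^g$/$\mathsf{last}^g$ at the first/last position (no last position in an $\omega$-word); $\mathsf{first}^c$/$\mathsf{last}^c$ where there is no class predecessor/successor; $\mathsf S$ at $i$ iff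 $i$ is not last and $i+1$ is the class successor of $i$; $\mathsf P$ at $i$ iff $i\neq1$ and $i-1$ is the class predecessor of $i$; $\mu,\nu$ least/greatest fixpoints. Equivalence: same denotation on every structure of the class under every valuation of free variables. The $\nu$-fragment: formulas without $\mu$. $\mathsf{Formulas}(M)$: formulas whose unary modalities all lie in $M$. For a set $\Psi$ of formulas: $\mathsf{Comp}^0(\Psi)=\emptyset$; $\mathsf{Comp}^{i+1}(\Psi)=\{\psi(\varphi_1,\dots,\varphi_n)\mid \psi(x_1,\dots,x_n)\in\Psi,\ \varphi_j\in\mathsf{Comp}^i(\Psi)\}$ ($\psi$ with free variables among $x_1,\dots,x_n$, capture-avoiding substitution); $\mathsf{Comp}(\Psi)=\bigcup_i\mathsf{Comp}^i(\Psi)$.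
   Formalization: The equality of Comp(...) with the ν-fragment is stated for closed ν-formulas only: since Comp^0 is empty, every formula of Comp is closed, and an open ν-formula such as a variable x is not equivalent to any closed formula. *)

theory Defs
  imports Main
begin

datatype ('a, 'd) data_word =
  Fin "('a \<times> 'd) list"
| Omega "nat \<Rightarrow> 'a \<times> 'd"

definition finite_words :: "('a, 'd) data_word set" where
  "finite_words = range Fin"

definition omega_words :: "('a, 'd) data_word set" where
  "omega_words = range Omega"

text \<open>Positions are numbered from 0.\<close>

fun positions :: "('a, 'd) data_word \<Rightarrow> nat set" where
  "positions (Fin w) = {..<length w}"
| "positions (Omega w) = UNIV"

fun entry :: "('a, 'd) data_word \<Rightarrow> nat \<Rightarrow> 'a \<times> 'd" where
  "entry (Fin w) i = w ! i"
| "entry (Omega w) i = w i"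

definition letter_at :: "('a, 'd) data_word \<Rightarrow> nat \<Rightarrow> 'a" where
  "letter_at w i = fst (entry w i)"

definition same_class :: "('a, 'd) data_word \<Rightarrow> nat \<Rightarrow> nat \<Rightarrow> bool" where
  "same_class w i j \<longleftrightarrow>
     i \<in> positions w \<and> j \<in> positions w \<and> snd (entry w i) = snd (entry w j)"

text \<open>In the next four relations the last argument is the (class) successor or predecessor of the
  position before it.\<close>

definition is_succ :: "('a, 'd) data_word \<Rightarrow> nat \<Rightarrow> nat \<Rightarrow> bool" where
  "is_succ w i j \<longleftrightarrow> i \<in> positions w \<and> j \<in> positions w \<and> j = i + 1"

definition is_pred :: "('a, 'd) data_word \<Rightarrow> nat \<Rightarrow> nat \<Rightarrow> bool" where
  "is_pred w i j \<longleftrightarrow> i \<in> positions w \<and> j \<in> positions w \<and> i = j + 1"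

definition is_class_succ :: "('a, 'd) data_word \<Rightarrow> nat \<Rightarrow> nat \<Rightarrow> bool" where
  "is_class_succ w i j \<longleftrightarrow>
     i < j \<and> same_class w i j \<and> (\<forall>k. i < k \<and> k < j \<longrightarrow> \<not> same_class w i k)"

definition is_class_pred :: "('a, 'd) data_word \<Rightarrow> nat \<Rightarrow> nat \<Rightarrow> bool" where
  "is_class_pred w i j \<longleftrightarrow>
     j < i \<and> same_class w i j \<and> (\<forall>k. j < k \<and> k < i \<longrightarrow> \<not> same_class w i k)"

datatype 'a atom =
  Letter 'a
| S_atom
| P_atom
| First_g
| Last_g
| First_c
| Last_c

datatype modality = Xg | Xc | Yg | Yc

text \<open>Fixpoint variables are de Bruijn indices: \<open>Mu\<close> and \<open>Nu\<close> bind index 0 of their body.\<close>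

datatype 'a fm =
  Var nat
| Atom "'a atom"
| NegAtom "'a atom"
| Mod modality "'a fm"
| Or "'a fm" "'a fm"
| And "'a fm" "'a fm"
| Mu "'a fm"
| Nu "'a fm"

primrec free_vars :: "'a fm \<Rightarrow> nat set" where
  "free_vars (Var x) = {x}"
| "free_vars (Atom a) = {}"
| "free_vars (NegAtom a) = {}"
| "free_vars (Mod m \<phi>) = free_vars \<phi>"
| "free_vars (Or \<phi> \<psi>) = free_vars \<phi> \<union> free_vars \<psi>"
| "free_vars (And \<phi> \<psi>) = free_vars \<phi> \<union> free_vars \<psi>"
| "free_vars (Mu \<phi>) = {x. Suc x \<in> free_vars \<phi>}"
| "free_vars (Nu \<phi>) = {x. Suc x \<in> free_vars \<phi>}"

primrec modalities :: "'a fm \<Rightarrow> modality set" where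
  "modalities (Var x) = {}"
| "modalities (Atom a) = {}"
| "modalities (NegAtom a) = {}"
| "modalities (Mod m \<phi>) = insert m (modalities \<phi>)"
| "modalities (Or \<phi> \<psi>) = modalities \<phi> \<union> modalities \<psi>"
| "modalities (And \<phi> \<psi>) = modalities \<phi> \<union> modalities \<psi>"
| "modalities (Mu \<phi>) = modalities \<phi>"
| "modalities (Nu \<phi>) = modalities \<phi>"

primrec mu_free :: "'a fm \<Rightarrow> bool" where
  "mu_free (Var x) \<longleftrightarrow> True"
| "mu_free (Atom a) \<longleftrightarrow> True"
| "mu_free (NegAtom a) \<longleftrightarrow> True"
| "mu_free (Mod m \<phi>) \<longleftrightarrow> mu_free \<phi>"
| "mu_free (Or \<phi> \<psi>) \<longleftrightarrow> mu_free \<phi> \<and> mu_free \<psi>"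
| "mu_free (And \<phi> \<psi>) \<longleftrightarrow> mu_free \<phi> \<and> mu_free \<psi>"
| "mu_free (Mu \<phi>) \<longleftrightarrow> False"
| "mu_free (Nu \<phi>) \<longleftrightarrow> mu_free \<phi>"

definition Formulas :: "modality set \<Rightarrow> 'a fm set" where
  "Formulas M = {\<phi>. modalities \<phi> \<subseteq> M}"

definition nu_fragment :: "'a fm set" where
  "nu_fragment = {\<phi>. mu_free \<phi>}"

primrec rename :: "(nat \<Rightarrow> nat) \<Rightarrow> 'a fm \<Rightarrow> 'a fm" where
  "rename r (Var x) = Var (r x)"
| "rename r (Atom a) = Atom a"
| "rename r (NegAtom a) = NegAtom a"
| "rename r (Mod m \<phi>) = Mod m (rename r \<phi>)"
| "rename r (Or \<phi> \<psi>) = Or (rename r \<phi>) (rename r \<psi>)"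
| "rename r (And \<phi> \<psi>) = And (rename r \<phi>) (rename r \<psi>)"
| "rename r (Mu \<phi>) = Mu (rename (case_nat 0 (\<lambda>x. Suc (r x))) \<phi>)"
| "rename r (Nu \<phi>) = Nu (rename (case_nat 0 (\<lambda>x. Suc (r x))) \<phi>)"

text \<open>Simultaneous capture-avoiding substitution: below a binder the substituted formulas have
  their free indices shifted by one.\<close>

primrec subst :: "(nat \<Rightarrow> 'a fm) \<Rightarrow> 'a fm \<Rightarrow> 'a fm" where
  "subst \<sigma> (Var x) = \<sigma> x"
| "subst \<sigma> (Atom a) = Atom a"
| "subst \<sigma> (NegAtom a) = NegAtom a"
| "subst \<sigma> (Mod m \<phi>) = Mod m (subst \<sigma> \<phi>)"
| "subst \<sigma> (Or \<phi> \<psi>) = Or (subst \<sigma> \<phi>) (subst \<sigma> \<psi>)"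
| "subst \<sigma> (And \<phi> \<psi>) = And (subst \<sigma> \<phi>) (subst \<sigma> \<psi>)"
| "subst \<sigma> (Mu \<phi>) = Mu (subst (case_nat (Var 0) (\<lambda>x. rename Suc (\<sigma> x))) \<phi>)"
| "subst \<sigma> (Nu \<phi>) = Nu (subst (case_nat (Var 0) (\<lambda>x. rename Suc (\<sigma> x))) \<phi>)"

text \<open>Since level 0 is empty, level 1 consists of the closed formulas of \<open>\<Psi>\<close> (the case
  \<open>n = 0\<close>); hence all formulas of \<open>Comp \<Psi>\<close> are closed.\<close>

primrec Comp_level :: "'a fm set \<Rightarrow> nat \<Rightarrow> 'a fm set" where
  "Comp_level \<Psi> 0 = {}"
| "Comp_level \<Psi> (Suc i) =
     {subst \<sigma> \<psi> | \<sigma> \<psi>. \<psi> \<in> \<Psi> \<and> (\<forall>x \<in> free_vars \<psi>. \<sigma> x \<in> Comp_level \<Psi> i)}"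

definition Comp :: "'a fm set \<Rightarrow> 'a fm set" where
  "Comp \<Psi> = (\<Union>i. Comp_level \<Psi> i)"

fun atom_holds :: "('a, 'd) data_word \<Rightarrow> nat \<Rightarrow> 'a atom \<Rightarrow> bool" where
  "atom_holds w i (Letter a) \<longleftrightarrow> letter_at w i = a"
| "atom_holds w i S_atom \<longleftrightarrow> is_class_succ w i (i + 1)"
| "atom_holds w i P_atom \<longleftrightarrow> i \<noteq> 0 \<and> is_class_pred w i (i - 1)"
| "atom_holds w i First_g \<longleftrightarrow> \<not> (\<exists>j. is_pred w i j)"
| "atom_holds w i Last_g \<longleftrightarrow> \<not> (\<exists>j. is_succ w i j)"
| "atom_holds w i First_c \<longleftrightarrow> \<not> (\<exists>j. is_class_pred w i j)"
| "atom_holds w i Last_c \<longleftrightarrow> \<not> (\<exists>j. is_class_succ w i j)"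

fun modality_rel :: "modality \<Rightarrow> ('a, 'd) data_word \<Rightarrow> nat \<Rightarrow> nat \<Rightarrow> bool" where
  "modality_rel Xg = is_succ"
| "modality_rel Xc = is_class_succ"
| "modality_rel Yg = is_pred"
| "modality_rel Yc = is_class_pred"

text \<open>The intersection in the variable clause makes every denotation a set of positions that
  depends only on the positions in the valuation. Therefore \<open>lfp\<close> and \<open>gfp\<close>, taken over all sets of
  natural numbers, are the least and greatest fixpoints among the sets of positions of \<open>w\<close>.\<close>

primrec sem :: "('a, 'd) data_word \<Rightarrow> (nat \<Rightarrow> nat set) \<Rightarrow> 'a fm \<Rightarrow> nat set" where
  "sem w V (Var x) = V x \<inter> positions w"
| "sem w V (Atom a) = {i \<in> positions w. atom_holds w i a}"
| "sem w V (NegAtom a) = {i \<in> positions w. \<not> atom_holds w i a}"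
| "sem w V (Mod m \<phi>) = {i \<in> positions w. \<exists>j. modality_rel m w i j \<and> j \<in> sem w V \<phi>}"
| "sem w V (Or \<phi> \<psi>) = sem w V \<phi> \<union> sem w V \<psi>"
| "sem w V (And \<phi> \<psi>) = sem w V \<phi> \<inter> sem w V \<psi>"
| "sem w V (Mu \<phi>) = lfp (\<lambda>X. sem w (case_nat X V) \<phi>)"
| "sem w V (Nu \<phi>) = gfp (\<lambda>X. sem w (case_nat X V) \<phi>)"

definition equivalent_over :: "('a, 'd) data_word set \<Rightarrow> 'a fm \<Rightarrow> 'a fm \<Rightarrow> bool" where
  "equivalent_over W \<phi> \<psi> \<longleftrightarrow>
     (\<forall>w \<in> W. \<forall>V. (\<forall>x. V x \<subseteq> positions w) \<longrightarrow> sem w V \<phi> = sem w V \<psi>)"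

end

theory Submission
  imports Defs
begin

text \<open>A past formula at position \<open>i\<close> depends only on positions up to \<open>i\<close>. If no fixpoint occurs
  outside the modalities of \<open>\<phi>\<close>, then an unguarded occurrence of \<open>x\<close> in \<open>\<phi>\<close> is evaluated at \<open>i\<close> itself,
  so it may be replaced by false in \<open>\<mu>x. \<phi>\<close> and by true in \<open>\<nu>x. \<phi>\<close>. Afterwards \<open>x\<close> is guarded, the
  fixpoint is unique by induction on positions, and \<open>\<mu>\<close> may be written as \<open>\<nu>\<close>. Unfolding the result
  once moves the fixpoint below the modalities again, which keeps the induction going.\<close>

section \<open>Substitution\<close>

lemma sem_subset_positions: "sem w V \<phi> \<subseteq> positions w"
proof (induction \<phi> arbitrary: V)
  case (Mu \<phi>)
  show ?case using Mu[of "case_nat (positions w) V"] by (simp add: lfp_lowerbound)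
next
  case (Nu \<phi>)
  have "gfp (\<lambda>X. sem w (case_nat X V) \<phi>) \<subseteq> positions w"
    by (rule gfp_least) (rule order_trans[OF _ Nu])
  then show ?case by simp
qed auto

lemma sem_mono:
  assumes "\<And>x. V x \<subseteq> V' x"
  shows "sem w V \<phi> \<subseteq> sem w V' \<phi>"
  using assms
proof (induction \<phi> arbitrary: V V')
  case (Var x)
  then show ?case by auto
next
  case (Mod m \<phi>)
  have "sem w V \<phi> \<subseteq> sem w V' \<phi>" using Mod by blast
  then show ?case by auto
next
  case (Or \<phi> \<psi>)
  have "sem w V \<phi> \<subseteq> sem w V' \<phi>" "sem w V \<psi> \<subseteq> sem w V' \<psi>" using Or by blast+
  then show ?case by auto
next
  case (And \<phi> \<psi>)
  have "sem w V \<phi> \<subseteq> sem w V' \<phi>" "sem w V \<psi> \<subseteq> sem w V' \<psi>" using And by blast+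
  then show ?case by auto
next
  case (Mu \<phi>)
  have "sem w (case_nat X V) \<phi> \<subseteq> sem w (case_nat X V') \<phi>" for X
    by (rule Mu.IH) (simp add: Mu.prems split: nat.split)
  then show ?case by (auto intro!: lfp_mono)
next
  case (Nu \<phi>)
  have "sem w (case_nat X V) \<phi> \<subseteq> sem w (case_nat X V') \<phi>" for X
    by (rule Nu.IH) (simp add: Nu.prems split: nat.split)
  then show ?case by (auto intro!: gfp_mono)
qed auto

lemma mono_sem_case_nat: "mono (\<lambda>X. sem w (case_nat X V) \<phi>)"
  by (intro monoI sem_mono) (auto split: nat.split)

text \<open>The variable clause of \<open>sem\<close> discards everything outside
  \<open>positions w\<close>. The tolerance matters for substitution, where
  \<open>sem w V (Var x)\<close> yields \<open>V x \<inter> positions w\<close> rather than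
  \<open>V x\<close>.\<close>

lemma sem_cong:
  assumes "\<And>x. x \<in> free_vars \<phi> \<Longrightarrow> V x \<inter> positions w = V' x \<inter> positions w"
  shows "sem w V \<phi> = sem w V' \<phi>"
  using assms
proof (induction \<phi> arbitrary: V V')
  case (Mod m \<phi>)
  have "sem w V \<phi> = sem w V' \<phi>" by (rule Mod.IH) (simp add: Mod.prems)
  then show ?case by simp
next
  case (Or \<phi> \<psi>)
  have "sem w V \<phi> = sem w V' \<phi>" by (rule Or.IH) (simp add: Or.prems)
  moreover have "sem w V \<psi> = sem w V' \<psi>" by (rule Or.IH) (simp add: Or.prems)
  ultimately show ?case by simp
next
  case (And \<phi> \<psi>)
  have "sem w V \<phi> = sem w V' \<phi>" by (rule And.IH) (simp add: And.prems)
  moreover have "sem w V \<psi> = sem w V' \<psi>" by (rule And.IH) (simp add: And.prems)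
  ultimately show ?case by simp
next
  case (Mu \<phi>)
  have "sem w (case_nat X V) \<phi> = sem w (case_nat X V') \<phi>" for X
  proof (rule Mu.IH)
    fix x assume "x \<in> free_vars \<phi>"
    then show "case_nat X V x \<inter> positions w = case_nat X V' x \<inter> positions w"
      using Mu.prems by (cases x) simp_all
  qed
  then show ?case by simp
next
  case (Nu \<phi>)
  have "sem w (case_nat X V) \<phi> = sem w (case_nat X V') \<phi>" for X
  proof (rule Nu.IH)
    fix x assume "x \<in> free_vars \<phi>"
    then show "case_nat X V x \<inter> positions w = case_nat X V' x \<inter> positions w"
      using Nu.prems by (cases x) simp_all
  qed
  then show ?case by simp
qed simp_all

section \<open>Semantics of renaming and substitution\<close>

lemma sem_rename: "sem w V (rename r \<phi>) = sem w (\<lambda>x. V (r x)) \<phi>"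
proof (induction \<phi> arbitrary: V r)
  case (Mu \<phi>)
  have "(\<lambda>x. case_nat X V (case_nat 0 (\<lambda>x. Suc (r x)) x)) = case_nat X (\<lambda>x. V (r x))" for X
    by (rule ext) (simp split: nat.split)
  then show ?case by (simp add: Mu.IH)
next
  case (Nu \<phi>)
  have "(\<lambda>x. case_nat X V (case_nat 0 (\<lambda>x. Suc (r x)) x)) = case_nat X (\<lambda>x. V (r x))" for X
    by (rule ext) (simp split: nat.split)
  then show ?case by (simp add: Nu.IH)
qed auto

lemma sem_subst_lift:
  "sem w (\<lambda>x. sem w (case_nat X V) (case_nat (Var 0) (\<lambda>x. rename Suc (\<sigma> x)) x)) \<phi>
   = sem w (case_nat X (\<lambda>x. sem w V (\<sigma> x))) \<phi>"
  by (rule sem_cong) (simp add: sem_rename split: nat.split)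

lemma sem_subst: "sem w V (subst \<sigma> \<phi>) = sem w (\<lambda>x. sem w V (\<sigma> x)) \<phi>"
proof (induction \<phi> arbitrary: V \<sigma>)
  case (Var x)
  show ?case using sem_subset_positions[of w V "\<sigma> x"] by auto
qed (simp_all add: sem_subst_lift)

lemma subst_Var [simp]: "subst Var \<phi> = \<phi>"
proof -
  have lift: "case_nat (Var 0) (\<lambda>x. Var (Suc x)) = Var"
    by (rule ext) (simp split: nat.split)
  show ?thesis by (induction \<phi>) (simp_all add: lift)
qed

section \<open>Syntactic invariants under renaming and substitution\<close>

lemma free_vars_rename: "free_vars (rename r \<phi>) = r ` free_vars \<phi>"
proof (induction \<phi> arbitrary: r)
  have *: "Suc y = case_nat 0 (\<lambda>x. Suc (r x)) x \<longleftrightarrow> (\<exists>z. x = Suc z \<and> y = r z)" for r x y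
    by (cases x) auto
  {
    case (Mu \<phi>)
    then show ?case by (auto simp: image_iff *)
  next
    case (Nu \<phi>)
    then show ?case by (auto simp: image_iff *)
  }
qed auto

lemma free_vars_subst: "free_vars (subst \<sigma> \<phi>) = (\<Union>x\<in>free_vars \<phi>. free_vars (\<sigma> x))"
proof (induction \<phi> arbitrary: \<sigma>)
  have *: "Suc y \<in> free_vars (case_nat (Var 0) (\<lambda>x. rename Suc (\<sigma> x)) x)
      \<longleftrightarrow> (\<exists>z. x = Suc z \<and> y \<in> free_vars (\<sigma> z))" for \<sigma> :: "nat \<Rightarrow> 'a fm" and x y
    by (cases x) (auto simp: free_vars_rename)
  {
    case (Mu \<phi>)
    then show ?case by (auto simp: *)
  next
    case (Nu \<phi>)
    then show ?case by (auto simp: *)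
  }
qed auto

lemma mu_free_rename [simp]: "mu_free (rename r \<phi>) = mu_free \<phi>"
  by (induction \<phi> arbitrary: r) auto

lemma mu_free_subst:
  assumes "mu_free \<phi>" "\<And>x. x \<in> free_vars \<phi> \<Longrightarrow> mu_free (\<sigma> x)"
  shows "mu_free (subst \<sigma> \<phi>)"
  using assms
proof (induction \<phi> arbitrary: \<sigma>)
  case (Nu \<phi>)
  have "mu_free (subst (case_nat (Var 0) (\<lambda>x. rename Suc (\<sigma> x))) \<phi>)"
  proof (rule Nu.IH)
    fix x assume "x \<in> free_vars \<phi>"
    then show "mu_free (case_nat (Var 0) (\<lambda>x. rename Suc (\<sigma> x)) x)"
      using Nu.prems by (cases x) simp_all
  qed (use Nu.prems in simp)
  then show ?case by simp
qed simp_all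

lemma modalities_rename [simp]: "modalities (rename r \<phi>) = modalities \<phi>"
  by (induction \<phi> arbitrary: r) auto

lemma modalities_subst:
  assumes "modalities \<phi> \<subseteq> M" "\<And>x. modalities (\<sigma> x) \<subseteq> M"
  shows "modalities (subst \<sigma> \<phi>) \<subseteq> M"
  using assms by (induction \<phi> arbitrary: \<sigma>) (auto split: nat.split)

section \<open>Guarded past formulas\<close>

lemma case_nat_Int_subset:
  assumes "A \<inter> I \<subseteq> B" "\<And>x. V x \<inter> I \<subseteq> V' x"
  shows "case_nat A V x \<inter> I \<subseteq> case_nat B V' x"
  using assms by (cases x) auto

text \<open>Past modalities never leave the window \<open>{..i}\<close>, so values beyond
  \<open>i\<close> do not matter. The one-sided form joins this locality with monotonicity and
  reduces each fixpoint case to a single pre- or postfixed point.\<close>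

lemma sem_past_mono:
  assumes "modalities \<phi> \<subseteq> {Yg, Yc}" "\<And>x. V x \<inter> {..i} \<subseteq> V' x"
  shows "sem w V \<phi> \<inter> {..i} \<subseteq> sem w V' \<phi>"
  using assms
proof (induction \<phi> arbitrary: V V')
  case (Mod m \<phi>)
  then have IH: "sem w V \<phi> \<inter> {..i} \<subseteq> sem w V' \<phi>" by simp
  have "j < k" if "modality_rel m w k j" for k j
    using Mod.prems(1) that by (auto simp: is_pred_def is_class_pred_def)
  then show ?case using IH by fastforce
next
  case (Or \<phi> \<psi>)
  then have "sem w V \<phi> \<inter> {..i} \<subseteq> sem w V' \<phi>" "sem w V \<psi> \<inter> {..i} \<subseteq> sem w V' \<psi>" by simp_all
  then show ?case by auto
next
  case (And \<phi> \<psi>)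
  then have "sem w V \<phi> \<inter> {..i} \<subseteq> sem w V' \<phi>" "sem w V \<psi> \<inter> {..i} \<subseteq> sem w V' \<psi>" by simp_all
  then show ?case by auto
next
  case (Mu \<phi>)
  let ?F = "\<lambda>X. sem w (case_nat X V) \<phi>" and ?F' = "\<lambda>X. sem w (case_nat X V') \<phi>"
  \<comment> \<open>Nothing is claimed beyond \<open>i\<close>, so all of \<open>{i<..}\<close> may
    be added to \<open>lfp ?F'\<close> to obtain a prefixed point of \<open>?F\<close>.\<close>
  have "?F (lfp ?F' \<union> {i<..}) \<inter> {..i} \<subseteq> ?F' (lfp ?F')"
    using Mu.prems by (intro Mu.IH case_nat_Int_subset) auto
  then have "?F (lfp ?F' \<union> {i<..}) \<subseteq> lfp ?F' \<union> {i<..}"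
    using lfp_unfold[OF mono_sem_case_nat, of w V' \<phi>] by force
  then have "lfp ?F \<subseteq> lfp ?F' \<union> {i<..}" by (rule lfp_lowerbound)
  then show ?case by auto
next
  case (Nu \<phi>)
  let ?F = "\<lambda>X. sem w (case_nat X V) \<phi>" and ?F' = "\<lambda>X. sem w (case_nat X V') \<phi>"
  \<comment> \<open>Dually, \<open>gfp ?F\<close> cut down to the window is a postfixed point of
    \<open>?F'\<close>.\<close>
  have "?F (gfp ?F) \<inter> {..i} \<subseteq> ?F' (gfp ?F \<inter> {..i})"
    using Nu.prems by (intro Nu.IH case_nat_Int_subset) auto
  then have "gfp ?F \<inter> {..i} \<subseteq> ?F' (gfp ?F \<inter> {..i})"
    using gfp_unfold[OF mono_sem_case_nat, of w V \<phi>] by force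
  then have "gfp ?F \<inter> {..i} \<subseteq> gfp ?F'" by (rule gfp_upperbound)
  then show ?case by simp
qed auto

text \<open>Outside all modalities there may be no fixpoint and no variable other than those in
  \<open>S\<close>; below a modality anything is allowed. The test never passes a binder, so indices
  are not shifted. \<open>S = - {0}\<close> expresses that index 0 is guarded.\<close>

primrec shallow :: "nat set \<Rightarrow> 'a fm \<Rightarrow> bool" where
  "shallow S (Var x) \<longleftrightarrow> x \<in> S"
| "shallow S (Atom a) \<longleftrightarrow> True"
| "shallow S (NegAtom a) \<longleftrightarrow> True"
| "shallow S (Mod m \<phi>) \<longleftrightarrow> True"
| "shallow S (Or \<phi> \<psi>) \<longleftrightarrow> shallow S \<phi> \<and> shallow S \<psi>"
| "shallow S (And \<phi> \<psi>) \<longleftrightarrow> shallow S \<phi> \<and> shallow S \<psi>"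
| "shallow S (Mu \<phi>) \<longleftrightarrow> False"
| "shallow S (Nu \<phi>) \<longleftrightarrow> False"

text \<open>Every occurrence of index 0 lies below a modality that moves strictly to the left, so at
  \<open>i\<close> only the part of \<open>X\<close> before \<open>i\<close> is consulted. This
  strictness drives the induction in \<open>mu_eq_guarded_nu\<close>.\<close>

lemma shallow_guarded_mono:
  assumes "shallow (- {0}) \<phi>" "modalities \<phi> \<subseteq> {Yg, Yc}" "X \<inter> {..<i} \<subseteq> Y"
    "i \<in> sem w (case_nat X V) \<phi>"
  shows "i \<in> sem w (case_nat Y V) \<phi>"
  using assms
proof (induction \<phi>)
  case (Var x)
  then show ?case by (cases x) auto
next
  case (Mod m \<phi>)
  then obtain j where j: "modality_rel m w i j" "j \<in> sem w (case_nat X V) \<phi>" by auto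
  then have "j < i" using Mod.prems(2) by (auto simp: is_pred_def is_class_pred_def)
  have "sem w (case_nat X V) \<phi> \<inter> {..j} \<subseteq> sem w (case_nat Y V) \<phi>"
    using Mod.prems \<open>j < i\<close> by (intro sem_past_mono case_nat_Int_subset) auto
  then show ?case using Mod.prems j by auto
qed auto

text \<open>Index 0 is guarded, so \<open>N\<close> lands only below modalities and may itself begin
  with a fixpoint.\<close>

lemma shallow_subst:
  assumes "shallow (- {0}) \<phi>"
  shows "shallow UNIV (subst (case_nat N Var) \<phi>)"
  using assms by (induction \<phi>) (auto split: nat.split)

text \<open>Unlike a substitution, this keeps the occurrences of index 0 below modalities. In a
  shallow formula the recursion meets no binder, so index 0 is always the variable of the fixpoint
  being treated.\<close>

primrec replace_unguarded :: "'a fm \<Rightarrow> 'a fm \<Rightarrow> 'a fm" where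
  "replace_unguarded c (Var x) = (if x = 0 then c else Var x)"
| "replace_unguarded c (Atom a) = Atom a"
| "replace_unguarded c (NegAtom a) = NegAtom a"
| "replace_unguarded c (Mod m \<phi>) = Mod m \<phi>"
| "replace_unguarded c (Or \<phi> \<psi>) = Or (replace_unguarded c \<phi>) (replace_unguarded c \<psi>)"
| "replace_unguarded c (And \<phi> \<psi>) = And (replace_unguarded c \<phi>) (replace_unguarded c \<psi>)"
| "replace_unguarded c (Mu \<phi>) = Mu \<phi>"
| "replace_unguarded c (Nu \<phi>) = Nu \<phi>"

lemma shallow_replace_unguarded:
  "shallow UNIV \<phi> \<Longrightarrow> shallow (- {0}) c \<Longrightarrow> shallow (- {0}) (replace_unguarded c \<phi>)"
  by (induction \<phi>) auto

lemma mu_free_replace_unguarded: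
  "mu_free \<phi> \<Longrightarrow> mu_free c \<Longrightarrow> mu_free (replace_unguarded c \<phi>)"
  by (induction \<phi>) auto

lemma modalities_replace_unguarded:
  "modalities (replace_unguarded c \<phi>) \<subseteq> modalities \<phi> \<union> modalities c"
  by (induction \<phi>) auto

lemma free_vars_replace_unguarded:
  "free_vars (replace_unguarded c \<phi>) \<subseteq> free_vars \<phi> \<union> free_vars c"
  by (induction \<phi>) auto

text \<open>Unguarded occurrences are evaluated at \<open>i\<close> itself and positively, so it is
  enough to compare \<open>V 0\<close> with \<open>c\<close> at this one position.
  \<open>replace_unguarded_antimono\<close> is the opposite direction.\<close>

lemma replace_unguarded_mono:
  assumes "i \<in> sem w V \<phi>" "i \<in> V 0 \<Longrightarrow> i \<in> sem w V c"
  shows "i \<in> sem w V (replace_unguarded c \<phi>)"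
  using assms by (induction \<phi>) auto

lemma replace_unguarded_antimono:
  assumes "i \<in> sem w V (replace_unguarded c \<phi>)" "i \<in> sem w V c \<Longrightarrow> i \<in> V 0"
  shows "i \<in> sem w V \<phi>"
proof -
  \<comment> \<open>In the variable case the premise on \<open>c\<close> yields only
    \<open>i \<in> V 0\<close>; the variable clause also demands
    \<open>i \<in> positions w\<close>.\<close>
  have "sem w V c \<subseteq> positions w" by (rule sem_subset_positions)
  with assms show ?thesis by (induction \<phi>) (auto split: if_splits)
qed

section \<open>Guarding the bound variable and turning \<mu> into \<nu>\<close>

definition Bot :: "'a fm" where "Bot = And (Atom First_g) (NegAtom First_g)"
definition Top :: "'a fm" where "Top = Or (Atom First_g) (NegAtom First_g)"

lemma sem_Bot [simp]: "sem w V Bot = {}"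
  by (auto simp: Bot_def)

lemma sem_Top [simp]: "sem w V Top = positions w"
  by (auto simp: Top_def)

text \<open>\<open>?U\<close> is a prefixed point of \<open>?F\<close> and hence contains
  \<open>lfp ?F\<close>. Conversely, guardedness forces \<open>?U\<close> into \<open>lfp ?F\<close>
  by strong induction on positions.\<close>

lemma mu_eq_guarded_nu:
  assumes "shallow UNIV \<phi>" "modalities \<phi> \<subseteq> {Yg, Yc}"
  shows "sem w V (Mu \<phi>) = sem w V (Nu (replace_unguarded Bot \<phi>))"
proof -
  let ?\<psi> = "replace_unguarded Bot \<phi>"
  let ?F = "\<lambda>X. sem w (case_nat X V) \<phi>" and ?G = "\<lambda>X. sem w (case_nat X V) ?\<psi>"
  let ?U = "gfp ?G"
  have guarded: "shallow (- {0}) ?\<psi>" "modalities ?\<psi> \<subseteq> {Yg, Yc}"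
    using assms shallow_replace_unguarded[of \<phi> Bot] modalities_replace_unguarded[of Bot \<phi>]
    by (auto simp: Bot_def)
  have L: "lfp ?F = ?F (lfp ?F)" and U: "?U = ?G ?U"
    by (rule lfp_unfold[OF mono_sem_case_nat] gfp_unfold[OF mono_sem_case_nat])+
  have "?F ?U \<subseteq> ?U"
  proof
    fix i assume "i \<in> ?F ?U"
    \<comment> \<open>If \<open>i \<notin> ?U\<close>, the unguarded occurrences are false at
      \<open>i\<close> anyway, so \<open>Bot\<close> may replace them; \<open>?U = ?G ?U\<close>
      then contradicts \<open>i \<notin> ?U\<close>.\<close>
    then have "i \<in> ?G ?U" if "i \<notin> ?U"
      by (rule replace_unguarded_mono) (simp add: that)
    then show "i \<in> ?U" using U by blast
  qed
  then have "lfp ?F \<subseteq> ?U" by (rule lfp_lowerbound)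
  moreover have "i \<in> ?U \<longrightarrow> i \<in> lfp ?F" for i
  proof (induction i rule: less_induct)
    case (less i)
    have "i \<in> ?F (lfp ?F)" if "i \<in> ?U"
    \<comment> \<open>The premise about \<open>Bot\<close> is vacuous, which leaves
      \<open>?G (lfp ?F)\<close>. Below \<open>i\<close> the induction hypothesis puts
      \<open>?U\<close> inside \<open>lfp ?F\<close>, and a guarded formula looks no
      further.\<close>
    proof (rule replace_unguarded_antimono[where c = Bot])
      have "i \<in> ?G ?U" using that U by blast
      then show "i \<in> ?G (lfp ?F)"
        by (rule shallow_guarded_mono[OF guarded, rotated]) (use less in blast)
    qed simp
    then show ?case using L by blast
  qed
  ultimately show ?thesis by auto
qed

text \<open>Each greatest fixpoint is a postfixed point of the other operator: at its own members an
  unguarded occurrence is true anyway, so \<open>Top\<close> changes nothing there.\<close>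

lemma nu_eq_guarded_nu:
  assumes "shallow UNIV \<phi>" "modalities \<phi> \<subseteq> {Yg, Yc}"
  shows "sem w V (Nu \<phi>) = sem w V (Nu (replace_unguarded Top \<phi>))"
proof -
  let ?\<psi> = "replace_unguarded Top \<phi>"
  let ?F = "\<lambda>X. sem w (case_nat X V) \<phi>" and ?G = "\<lambda>X. sem w (case_nat X V) ?\<psi>"
  let ?U = "gfp ?G"
  have K: "gfp ?F = ?F (gfp ?F)" and U: "?U = ?G ?U"
    by (rule gfp_unfold[OF mono_sem_case_nat])+
  have "?U \<subseteq> ?F ?U"
  proof
    fix i assume i: "i \<in> ?U"
    then have "i \<in> ?G ?U" using U by blast
    then show "i \<in> ?F ?U" by (rule replace_unguarded_antimono) (simp add: i)
  qed
  then have "?U \<subseteq> gfp ?F" by (rule gfp_upperbound)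
  moreover have "gfp ?F \<subseteq> ?G (gfp ?F)"
  proof
    fix i assume i: "i \<in> gfp ?F"
    then have "i \<in> ?F (gfp ?F)" using K by blast
    \<comment> \<open>This is what makes \<open>Top\<close> true at \<open>i\<close>.\<close>
    moreover then have "i \<in> positions w" using sem_subset_positions by blast
    ultimately show "i \<in> ?G (gfp ?F)" by (intro replace_unguarded_mono) simp_all
  qed
  then have "gfp ?F \<subseteq> ?U" by (rule gfp_upperbound)
  ultimately show ?thesis by simp
qed

section \<open>Unfolding and the normal form of past formulas\<close>

lemma sem_Nu_unfold: "sem w V (subst (case_nat (Nu \<phi>) Var) \<phi>) = sem w V (Nu \<phi>)"
proof -
  have "sem w V (subst (case_nat (Nu \<phi>) Var) \<phi>) = sem w (case_nat (sem w V (Nu \<phi>)) V) \<phi>"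
    unfolding sem_subst using sem_subset_positions[of w V "Nu \<phi>"]
    by (intro sem_cong) (auto split: nat.split)
  also have "\<dots> = sem w V (Nu \<phi>)"
    using gfp_unfold[OF mono_sem_case_nat, of w V \<phi>] by simp
  finally show ?thesis .
qed

text \<open>The induction invariant: remaining fixpoints sit below modalities, so an enclosing
  fixpoint can be guarded in turn.\<close>

definition past_normal :: "'a fm \<Rightarrow> bool" where
  "past_normal \<phi> \<longleftrightarrow> mu_free \<phi> \<and> shallow UNIV \<phi> \<and> modalities \<phi> \<subseteq> {Yg, Yc}"

text \<open>\<open>Nu \<psi>\<close> is not shallow, but its unfolding is, because index 0 is
  guarded in \<open>\<psi>\<close>. Taking \<open>Bot\<close> or \<open>Top\<close> for
  \<open>c\<close> serves \<mu> and \<nu> alike.\<close>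

lemma past_normal_Nu_unfold:
  assumes "past_normal \<phi>" "shallow (- {0}) c" "mu_free c" "modalities c = {}" "free_vars c = {}"
  defines "\<psi> \<equiv> replace_unguarded c \<phi>"
  shows "past_normal (subst (case_nat (Nu \<psi>) Var) \<psi>)"
    and "free_vars (subst (case_nat (Nu \<psi>) Var) \<psi>) \<subseteq> free_vars (Nu \<phi>)"
proof -
  have 1: "mu_free \<psi>" "shallow (- {0}) \<psi>" "modalities \<psi> \<subseteq> {Yg, Yc}"
    using assms mu_free_replace_unguarded[of \<phi> c] shallow_replace_unguarded[of \<phi> c]
      modalities_replace_unguarded[of c \<phi>]
    by (auto simp: past_normal_def)
  have 2: "free_vars \<psi> \<subseteq> free_vars \<phi>"
    using assms free_vars_replace_unguarded[of c \<phi>] by auto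
  show "past_normal (subst (case_nat (Nu \<psi>) Var) \<psi>)"
    using 1 unfolding past_normal_def
    by (intro conjI mu_free_subst shallow_subst modalities_subst) (auto split: nat.split)
  show "free_vars (subst (case_nat (Nu \<psi>) Var) \<psi>) \<subseteq> free_vars (Nu \<phi>)"
    using 2 by (auto simp: free_vars_subst split: nat.splits)
qed

text \<open>The witness is chosen before \<open>w\<close> and \<open>V\<close>, so one formula
  serves finite and infinite words. The bound on free variables is carried along for
  \<open>Comp\<close>, which constrains substituted formulas only at free variables of the outer
  one.\<close>

lemma ex_past_normal:
  assumes "modalities \<phi> \<subseteq> {Yg, Yc}"
  shows "\<exists>\<psi>. past_normal \<psi> \<and> free_vars \<psi> \<subseteq> free_vars \<phi>
    \<and> (\<forall>(w :: ('a, 'd) data_word) V. sem w V (\<phi> :: 'a fm) = sem w V \<psi>)"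
  using assms
proof (induction \<phi>)
  case (Var x)
  show ?case by (rule exI[of _ "Var x"]) (simp add: past_normal_def)
next
  case (Atom a)
  show ?case by (rule exI[of _ "Atom a"]) (simp add: past_normal_def)
next
  case (NegAtom a)
  show ?case by (rule exI[of _ "NegAtom a"]) (simp add: past_normal_def)
next
  case (Mod m \<phi>)
  then obtain \<phi>' where "past_normal \<phi>'" "free_vars \<phi>' \<subseteq> free_vars \<phi>"
    "\<forall>(w :: ('a, 'd) data_word) V. sem w V \<phi> = sem w V \<phi>'" by auto
  then show ?case using Mod.prems by (intro exI[of _ "Mod m \<phi>'"]) (simp add: past_normal_def)
next
  case (Or \<phi> \<psi>)
  then obtain \<phi>' \<psi>' where "past_normal \<phi>'" "free_vars \<phi>' \<subseteq> free_vars \<phi>"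
    "\<forall>(w :: ('a, 'd) data_word) V. sem w V \<phi> = sem w V \<phi>'"
    "past_normal \<psi>'" "free_vars \<psi>' \<subseteq> free_vars \<psi>"
    "\<forall>(w :: ('a, 'd) data_word) V. sem w V \<psi> = sem w V \<psi>'" by (metis Un_subset_iff modalities.simps(5))
  then show ?case by (intro exI[of _ "Or \<phi>' \<psi>'"]) (auto simp add: past_normal_def)
next
  case (And \<phi> \<psi>)
  then obtain \<phi>' \<psi>' where "past_normal \<phi>'" "free_vars \<phi>' \<subseteq> free_vars \<phi>"
    "\<forall>(w :: ('a, 'd) data_word) V. sem w V \<phi> = sem w V \<phi>'"
    "past_normal \<psi>'" "free_vars \<psi>' \<subseteq> free_vars \<psi>"
    "\<forall>(w :: ('a, 'd) data_word) V. sem w V \<psi> = sem w V \<psi>'" by (metis Un_subset_iff modalities.simps(6))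
  then show ?case by (intro exI[of _ "And \<phi>' \<psi>'"]) (auto simp add: past_normal_def)
next
  case (Mu \<phi>)
  then obtain \<phi>' where \<phi>': "past_normal \<phi>'" "free_vars \<phi>' \<subseteq> free_vars \<phi>"
    "\<forall>(w :: ('a, 'd) data_word) V. sem w V \<phi> = sem w V \<phi>'" by auto
  let ?\<psi> = "replace_unguarded Bot \<phi>'"
  \<comment> \<open>Equality under every valuation, in particular every \<open>case_nat X V\<close>,
    carries \<open>\<phi>\<close> to \<open>\<phi>'\<close> under the binder.\<close>
  have "sem w V (Mu \<phi>) = sem w V (Nu ?\<psi>)" for w :: "('a, 'd) data_word" and V
    using \<phi>' mu_eq_guarded_nu[of \<phi>' w V] by (simp add: past_normal_def)
  then show ?case
    using \<phi>' past_normal_Nu_unfold[of \<phi>' Bot]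
    by (intro exI[of _ "subst (case_nat (Nu ?\<psi>) Var) ?\<psi>"]) (auto simp: Bot_def sem_Nu_unfold)
next
  case (Nu \<phi>)
  then obtain \<phi>' where \<phi>': "past_normal \<phi>'" "free_vars \<phi>' \<subseteq> free_vars \<phi>"
    "\<forall>(w :: ('a, 'd) data_word) V. sem w V \<phi> = sem w V \<phi>'" by auto
  let ?\<psi> = "replace_unguarded Top \<phi>'"
  have "sem w V (Nu \<phi>) = sem w V (Nu ?\<psi>)" for w :: "('a, 'd) data_word" and V
    using \<phi>' nu_eq_guarded_nu[of \<phi>' w V] by (simp add: past_normal_def)
  then show ?case
    using \<phi>' past_normal_Nu_unfold[of \<phi>' Top]
    by (intro exI[of _ "subst (case_nat (Nu ?\<psi>) Var) ?\<psi>"]) (auto simp: Top_def sem_Nu_unfold)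
qed

section \<open>The composition closure\<close>

lemma ex_mu_free:
  assumes "\<phi> \<in> Formulas {Yg, Yc} \<union> nu_fragment"
  shows "\<exists>\<psi>. mu_free \<psi> \<and> free_vars \<psi> \<subseteq> free_vars \<phi>
    \<and> (\<forall>(w :: ('a, 'd) data_word) V. sem w V (\<phi> :: 'a fm) = sem w V \<psi>)"
proof (cases "mu_free \<phi>")
  case False
  then have "modalities \<phi> \<subseteq> {Yg, Yc}"
    using assms by (auto simp: Formulas_def nu_fragment_def)
  then show ?thesis
    using ex_past_normal[of \<phi>, where ?'d = 'd] unfolding past_normal_def by blast
qed blast

text \<open>Outer and substituted formulas are replaced independently, and \<open>sem_subst\<close>
  recombines their meanings. Closedness propagates from the empty level 0.\<close>

lemma Comp_level_ex_mu_free: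
  assumes "\<phi> \<in> Comp_level (Formulas {Yg, Yc} \<union> nu_fragment) n"
  shows "\<exists>\<psi>. mu_free \<psi> \<and> free_vars \<psi> = {}
    \<and> (\<forall>(w :: ('a, 'd) data_word) V. sem w V (\<phi> :: 'a fm) = sem w V \<psi>)"
  using assms
proof (induction n arbitrary: \<phi>)
  case (Suc n)
  then obtain \<sigma> \<psi> where \<phi>: "\<phi> = subst \<sigma> \<psi>" and \<psi>: "\<psi> \<in> Formulas {Yg, Yc} \<union> nu_fragment"
    and \<sigma>: "\<forall>x\<in>free_vars \<psi>. \<sigma> x \<in> Comp_level (Formulas {Yg, Yc} \<union> nu_fragment) n"
    by auto
  from \<sigma> Suc.IH have "\<forall>x\<in>free_vars \<psi>. \<exists>\<chi>. mu_free \<chi> \<and> free_vars \<chi> = {}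
      \<and> (\<forall>(w :: ('a, 'd) data_word) V. sem w V (\<sigma> x) = sem w V \<chi>)" by blast
  then obtain \<tau> where \<tau>: "\<And>x. x \<in> free_vars \<psi> \<Longrightarrow> mu_free (\<tau> x) \<and> free_vars (\<tau> x) = {}
      \<and> (\<forall>(w :: ('a, 'd) data_word) V. sem w V (\<sigma> x) = sem w V (\<tau> x))" by metis
  from ex_mu_free[OF \<psi>] obtain \<psi>' where \<psi>': "mu_free \<psi>'" "free_vars \<psi>' \<subseteq> free_vars \<psi>"
    "\<And>(w :: ('a, 'd) data_word) V. sem w V \<psi> = sem w V \<psi>'" by blast
  have "sem w V \<phi> = sem w V (subst \<tau> \<psi>')" for w :: "('a, 'd) data_word" and V
  proof -
    have "sem w V \<phi> = sem w (\<lambda>x. sem w V (\<sigma> x)) \<psi>'" by (simp add: \<phi> sem_subst \<psi>'(3))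
    \<comment> \<open>\<open>\<sigma>\<close> and \<open>\<tau>\<close> are known to agree in
      meaning only on \<open>free_vars \<psi>\<close>, which contains
      \<open>free_vars \<psi>'\<close>.\<close>
    also have "\<dots> = sem w (\<lambda>x. sem w V (\<tau> x)) \<psi>'"
      using \<tau> \<psi>'(2) by (intro sem_cong) blast
    finally show ?thesis by (simp add: sem_subst)
  qed
  moreover have "mu_free (subst \<tau> \<psi>')"
    using \<tau> \<psi>' by (intro mu_free_subst) auto
  moreover have "free_vars (subst \<tau> \<psi>') = {}"
    using \<tau> \<psi>' by (auto simp: free_vars_subst)
  ultimately show ?case by blast
qed simp

lemma closed_in_Comp:
  assumes "\<phi> \<in> \<Psi>" "free_vars \<phi> = {}"
  shows "\<phi> \<in> Comp \<Psi>"
proof -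
  \<comment> \<open>For a closed formula the condition on the substitution is vacuous, and the
    identity \<open>Var\<close> returns \<open>\<phi>\<close>.\<close>
  have "\<phi> \<in> Comp_level \<Psi> 1"
    using assms by (auto intro!: exI[of _ Var] exI[of _ \<phi>])
  then show ?thesis unfolding Comp_def by blast
qed

theorem theorem7:
  assumes infinite_data: "infinite (UNIV :: 'd set)"
  shows
    "(\<forall>\<phi> \<in> Formulas {Yg, Yc} :: 'a::finite fm set.
        \<exists>\<psi> \<in> nu_fragment.
          equivalent_over (omega_words :: ('a, 'd) data_word set) \<phi> \<psi>) \<and>
     (\<forall>W \<in> {finite_words, omega_words :: ('a, 'd) data_word set}.
        (\<forall>\<phi> \<in> Comp (Formulas {Yg, Yc} \<union> nu_fragment).
           \<exists>\<psi> \<in> nu_fragment. free_vars \<psi> = {} \<and> equivalent_over W \<phi> \<psi>) \<and>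
        (\<forall>\<psi> \<in> nu_fragment. free_vars \<psi> = {} \<longrightarrow>
           (\<exists>\<phi> \<in> Comp (Formulas {Yg, Yc} \<union> nu_fragment). equivalent_over W \<phi> \<psi>)))"
proof (intro conjI ballI impI)
  fix \<phi> :: "'a fm"
  assume "\<phi> \<in> Formulas {Yg, Yc}"
  then show "\<exists>\<psi>\<in>nu_fragment. equivalent_over (omega_words :: ('a, 'd) data_word set) \<phi> \<psi>"
    using ex_mu_free[of \<phi>, where ?'d = 'd]
    by (auto simp: nu_fragment_def equivalent_over_def)
next
  fix W :: "('a, 'd) data_word set" and \<phi> :: "'a fm"
  assume "\<phi> \<in> Comp (Formulas {Yg, Yc} \<union> nu_fragment)"
  then obtain n where "\<phi> \<in> Comp_level (Formulas {Yg, Yc} \<union> nu_fragment) n"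
    by (auto simp: Comp_def)
  then show "\<exists>\<psi>\<in>nu_fragment. free_vars \<psi> = {} \<and> equivalent_over W \<phi> \<psi>"
    using Comp_level_ex_mu_free[of \<phi> n, where ?'d = 'd]
    by (auto simp: nu_fragment_def equivalent_over_def)
next
  fix W :: "('a, 'd) data_word set" and \<psi> :: "'a fm"
  assume "\<psi> \<in> nu_fragment" "free_vars \<psi> = {}"
  \<comment> \<open>The closed \<nu>-formula lies in the closure and is its own witness.\<close>
  then have "\<psi> \<in> Comp (Formulas {Yg, Yc} \<union> nu_fragment)"
    by (intro closed_in_Comp) auto
  then show "\<exists>\<phi>\<in>Comp (Formulas {Yg, Yc} \<union> nu_fragment). equivalent_over W \<phi> \<psi>"
    by (auto simp: equivalent_over_def)
qed

end
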